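(* Let $M$ and $N$ be matroids on disjoint finite sets $S$ and $T$, let $A\subseteq S$, $B\subseteq T$, and let $P=(M,N;A,B)$. For $X\subseteq S$ and $Y\subseteq T$, \[\mathrm{cl}_P(X\cup Y)=\begin{cases}\mathrm{cl}_M(X\cup A)\cup\mathrm{cl}_N(Y), & \text{if } r_M(X\cup A)+r_N(Y)\le r_M(X)+r_N(Y-B)+|Y\cap B|,\\ \mathrm{cl}_M(X)\cup \mathrm{cl}_{N\setminus B}(Y-B)\cup(Y\cap B), & \text{otherwise.}\end{cases}\]
   Context: The principal sum $(M,N;A,B)$ is the matroid union $M^+(A,B)\vee N_0$, where: $N_0=N\oplus U_{0,S}$ ($N$ with the elements of $S$ added as loops); $M^+(A,B)$ is the matroid on $S\cup T$ obtained from $M$ by adding each element of $B$ freely (by successive principal extensions) to the flat $\mathrm{cl}_M(A)$ and each element of $T-B$ as a loop, equivalently the matroid with rank function $r(X\cup Y)=\min\{r_M(X\cup A),\,r_M(X)+|Y\cap B|\}$ for $X\subseteq S$, $Y\subseteq T$; and the matroid union $G\vee H$ of matroids on a common set has as independent sets the unions of an independent set of $G$ and an independent set of $H$. $\mathrm{cl}_{N\setminus B}$ denotes closure in the deletion $N\setminus B$. *)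

theory Defs
  imports Main
begin

record 'a set_system =
  ground :: "'a set"
  indeps :: "'a set set"

definition matroid :: "'a set_system \<Rightarrow> bool" where
  "matroid M \<longleftrightarrow>
     finite (ground M) \<and>
     indeps M \<subseteq> Pow (ground M) \<and>
     {} \<in> indeps M \<and>
     (\<forall>I J. J \<in> indeps M \<longrightarrow> I \<subseteq> J \<longrightarrow> I \<in> indeps M) \<and>
     (\<forall>I J. I \<in> indeps M \<longrightarrow> J \<in> indeps M \<longrightarrow> card I < card J \<longrightarrow>
        (\<exists>x\<in>J - I. insert x I \<in> indeps M))"

definition mrank :: "'a set_system \<Rightarrow> 'a set \<Rightarrow> nat" where
  "mrank M X = Max (card ` {I \<in> indeps M. I \<subseteq> X})"

definition mclosure :: "'a set_system \<Rightarrow> 'a set \<Rightarrow> 'a set" where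
  "mclosure M X = {x \<in> ground M. mrank M (insert x X) = mrank M X}"

definition deletion :: "'a set_system \<Rightarrow> 'a set \<Rightarrow> 'a set_system" where
  "deletion M D = \<lparr>ground = ground M - D, indeps = {I \<in> indeps M. I \<inter> D = {}}\<rparr>"

definition uniform_matroid :: "nat \<Rightarrow> 'a set \<Rightarrow> 'a set_system" where
  "uniform_matroid k E = \<lparr>ground = E, indeps = {I. I \<subseteq> E \<and> card I \<le> k}\<rparr>"

definition direct_sum :: "'a set_system \<Rightarrow> 'a set_system \<Rightarrow> 'a set_system" where
  "direct_sum M N =
     \<lparr>ground = ground M \<union> ground N, indeps = {I \<union> J | I J. I \<in> indeps M \<and> J \<in> indeps N}\<rparr>"

text \<open>The definition of the matroid union is literally the same formula as that of the direct
  sum; the union is applied to matroids on a common ground set, the direct sum to matroids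
  on disjoint ground sets.\<close>

definition matroid_union :: "'a set_system \<Rightarrow> 'a set_system \<Rightarrow> 'a set_system" where
  "matroid_union G H =
     \<lparr>ground = ground G \<union> ground H, indeps = {I \<union> J | I J. I \<in> indeps G \<and> J \<in> indeps H}\<rparr>"

text \<open>\<open>plus_matroid_rank M A B\<close> is the rank function of $M^+(A,B)$: for a subset $Z$ of
  $S \cup T$, where $S$ is the ground set of $M$ and $B \subseteq T$ is disjoint from $S$, one
  has $X = Z \cap S$ and $Y \cap B = Z \cap B$. A matroid is determined by its rank
  function \<open>r\<close>: its independent sets are the \<open>Z\<close> with \<open>r Z = card Z\<close>. That
  \<open>plus_matroid M T A B\<close> is indeed a matroid with this rank function, and that it arises from \<open>M\<close>
  by successive principal extensions, is shown in \<open>matroid_plus\<close>, \<open>rank_plus\<close> and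
  \<open>plus_eq_principal_extensions\<close> below.\<close>

definition plus_matroid_rank :: "'a set_system \<Rightarrow> 'a set \<Rightarrow> 'a set \<Rightarrow> 'a set \<Rightarrow> nat" where
  "plus_matroid_rank M A B Z =
     min (mrank M (Z \<inter> ground M \<union> A)) (mrank M (Z \<inter> ground M) + card (Z \<inter> B))"

definition plus_matroid :: "'a set_system \<Rightarrow> 'a set \<Rightarrow> 'a set \<Rightarrow> 'a set \<Rightarrow> 'a set_system" where
  "plus_matroid M T A B =
     \<lparr>ground = ground M \<union> T, indeps = {Z. Z \<subseteq> ground M \<union> T \<and> plus_matroid_rank M A B Z = card Z}\<rparr>"

definition principal_sum ::
    "'a set_system \<Rightarrow> 'a set_system \<Rightarrow> 'a set \<Rightarrow> 'a set \<Rightarrow> 'a set_system" where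
  "principal_sum M N A B =
     matroid_union (plus_matroid M (ground N) A B) (direct_sum N (uniform_matroid 0 (ground M)))"

text \<open>Principal extension of \<open>M\<close>: the new element \<open>e\<close> is added freely to the
  flat \<open>F\<close>.\<close>

definition principal_extension :: "'a set_system \<Rightarrow> 'a set \<Rightarrow> 'a \<Rightarrow> 'a set_system" where
  "principal_extension M F e =
     \<lparr>ground = insert e (ground M),
      indeps = indeps M \<union> {insert e I | I. I \<in> indeps M \<and> \<not> F \<subseteq> mclosure M I}\<rparr>"


subsection \<open>Rank functions\<close>

text \<open>Unit increase and local submodularity characterize the rank functions of matroids.\<close>

definition rank_fun :: "'a set \<Rightarrow> ('a set \<Rightarrow> nat) \<Rightarrow> bool" where
  "rank_fun E r \<longleftrightarrow> finite E \<and> r {} = 0 \<and>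
     (\<forall>Z x. Z \<subseteq> E \<longrightarrow> x \<in> E \<longrightarrow> r Z \<le> r (insert x Z) \<and> r (insert x Z) \<le> Suc (r Z)) \<and>
     (\<forall>Z x y. Z \<subseteq> E \<longrightarrow> x \<in> E \<longrightarrow> y \<in> E \<longrightarrow> r (insert x Z) = r Z \<longrightarrow> r (insert y Z) = r Z \<longrightarrow>
        r (insert y (insert x Z)) = r Z)"

lemma rank_fun_insert:
  assumes "rank_fun E r" "Z \<subseteq> E" "x \<in> E"
  shows "r Z \<le> r (insert x Z)" "r (insert x Z) \<le> Suc (r Z)"
  using assms unfolding rank_fun_def by blast+

lemma rank_fun_local:
  assumes "rank_fun E r" "Z \<subseteq> E" "x \<in> E" "y \<in> E" "r (insert x Z) = r Z" "r (insert y Z) = r Z"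
  shows "r (insert y (insert x Z)) = r Z"
  using assms unfolding rank_fun_def by blast

lemma rank_fun_mono:
  assumes "rank_fun E r" "Z \<subseteq> W" "W \<subseteq> E"
  shows "r Z \<le> r W"
proof -
  have "finite (W - Z)" using assms by (meson finite_Diff finite_subset rank_fun_def)
  moreover have "finite D \<Longrightarrow> D \<subseteq> E \<Longrightarrow> r Z \<le> r (Z \<union> D)" for D
  proof (induction D rule: finite_induct)
    case (insert x D)
    have "r (Z \<union> D) \<le> r (insert x (Z \<union> D))"
      using assms insert by (simp add: rank_fun_def)
    then show ?case using insert by simp
  qed simp
  ultimately have "r Z \<le> r (Z \<union> (W - Z))" using assms by blast
  then show ?thesis using assms by (simp add: Un_absorb1)
qed

lemma rank_fun_le_add_card:
  assumes "rank_fun E r" "Z \<subseteq> E" "finite D" "D \<subseteq> E"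
  shows "r (Z \<union> D) \<le> r Z + card D"
  using assms(3,4)
proof (induction D rule: finite_induct)
  case (insert x D)
  have "r (insert x (Z \<union> D)) \<le> Suc (r (Z \<union> D))"
    using assms insert by (simp add: rank_fun_def)
  then show ?case using insert by simp
qed simp

lemma rank_fun_le_card:
  assumes "rank_fun E r" "Z \<subseteq> E"
  shows "r Z \<le> card Z"
proof -
  have "finite Z" "r {} = 0" using assms finite_subset by (auto simp: rank_fun_def)
  then show ?thesis using rank_fun_le_add_card[OF assms(1), of "{}" Z] assms(2) by simp
qed

lemma rank_fun_absorb:
  assumes "rank_fun E r" "Z \<subseteq> E" "finite W" "W \<subseteq> E" "\<And>x. x \<in> W \<Longrightarrow> r (insert x Z) = r Z"
  shows "r (Z \<union> W) = r Z"
proof -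
  have "\<forall>Z. Z \<subseteq> E \<longrightarrow> (\<forall>x\<in>W. r (insert x Z) = r Z) \<longrightarrow> r (Z \<union> W) = r Z"
    using assms(3,4)
  proof (induction W rule: finite_induct)
    case (insert w W)
    show ?case
    proof (intro allI impI)
      fix Z assume Z: "Z \<subseteq> E" and eq: "\<forall>x\<in>insert w W. r (insert x Z) = r Z"
      have w: "w \<in> E" "W \<subseteq> E" using insert.prems by auto
      have "r (insert x (insert w Z)) = r (insert w Z)" if "x \<in> W" for x
        using rank_fun_local[OF assms(1) Z w(1), of x] eq w(2) that by auto
      then have "r (insert w Z \<union> W) = r (insert w Z)"
        using insert.IH[OF w(2)] w Z by (meson insert_subset)
      then show "r (Z \<union> insert w W) = r Z" using eq by simp
    qed
  qed simp
  then show ?thesis using assms(2,5) by simp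
qed

lemma rank_fun_indep_subset:
  assumes "rank_fun E r" "J \<subseteq> E" "r J = card J" "I \<subseteq> J"
  shows "r I = card I"
proof -
  have fin: "finite J" using assms by (meson finite_subset rank_fun_def)
  have "r (I \<union> (J - I)) \<le> r I + card (J - I)"
    using rank_fun_le_add_card[OF assms(1)] assms fin by blast
  then have "card J \<le> r I + card (J - I)" using assms by (simp add: Un_absorb1)
  moreover have "card (J - I) = card J - card I" "card I \<le> card J"
    using assms fin by (auto simp: card_Diff_subset finite_subset card_mono)
  moreover have "r I \<le> card I" using rank_fun_le_card[OF assms(1)] assms by blast
  ultimately show ?thesis by linarith
qed

lemma rank_fun_not_extendable:
  assumes "rank_fun E r" "I \<subseteq> E" "r I = card I" "W \<subseteq> E"
    and "\<And>x. x \<in> W - I \<Longrightarrow> r (insert x I) \<noteq> card (insert x I)"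
  shows "r (I \<union> W) = r I"
proof (rule rank_fun_absorb[OF assms(1,2) _ assms(4)])
  show "finite W" using assms by (meson finite_subset rank_fun_def)
  fix x assume x: "x \<in> W"
  have "finite I" using assms by (meson finite_subset rank_fun_def)
  show "r (insert x I) = r I"
  proof (cases "x \<in> I")
    case False
    then have "r (insert x I) \<noteq> Suc (r I)" using assms x \<open>finite I\<close> by auto
    moreover have "r I \<le> r (insert x I) \<and> r (insert x I) \<le> Suc (r I)"
      using rank_fun_insert[OF assms(1,2), of x] assms x by blast
    ultimately show ?thesis by linarith
  qed (simp add: insert_absorb)
qed

lemma matroid_of_rank_fun:
  assumes r: "rank_fun E r"
  shows "matroid \<lparr>ground = E, indeps = {Z. Z \<subseteq> E \<and> r Z = card Z}\<rparr>"
proof -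
  have "\<exists>x\<in>J - I. x \<in> E \<and> r (insert x I) = card (insert x I)"
    if I: "I \<subseteq> E" "r I = card I" and J: "J \<subseteq> E" "r J = card J" and lt: "card I < card J" for I J
  proof (rule ccontr)
    assume "\<not> ?thesis"
    then have "r (I \<union> J) = r I"
      using rank_fun_not_extendable[OF r, of I J] I J by blast
    moreover have "r J \<le> r (I \<union> J)" using rank_fun_mono[OF r, of J "I \<union> J"] I J by blast
    ultimately show False using I J lt by simp
  qed
  note augment = this
  have hereditary: "I \<subseteq> E \<and> r I = card I" if "J \<subseteq> E" "r J = card J" "I \<subseteq> J" for I J
    using that rank_fun_indep_subset[OF r] by blast
  have "finite E" "r {} = 0" using r by (simp_all add: rank_fun_def)
  then show ?thesis unfolding matroid_def set_system.simps mem_Collect_eq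
  proof (intro conjI allI impI)
    show "{Z. Z \<subseteq> E \<and> r Z = card Z} \<subseteq> Pow E" by blast
    fix I J
    show "\<exists>x\<in>J - I. insert x I \<subseteq> E \<and> r (insert x I) = card (insert x I)"
      if "I \<subseteq> E \<and> r I = card I" "J \<subseteq> E \<and> r J = card J" "card I < card J"
      using that augment[of I J] by simp
    show "I \<subseteq> E" "r I = card I" if "J \<subseteq> E \<and> r J = card J" "I \<subseteq> J"
      using that hereditary[of J I] by simp_all
  qed simp_all
qed

lemma matroidD:
  assumes "matroid M"
  shows "finite (ground M)" "indeps M \<subseteq> Pow (ground M)" "{} \<in> indeps M"
  using assms by (simp_all add: matroid_def)

lemma finite_indeps_below:
  assumes "finite (ground M)" "indeps M \<subseteq> Pow (ground M)"
  shows "finite {I \<in> indeps M. I \<subseteq> X}"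
  by (rule finite_subset[of _ "Pow (ground M)"]) (use assms in auto)

lemma rank_of_rank_fun:
  assumes r: "rank_fun E r" and Z: "Z \<subseteq> E"
  shows "mrank \<lparr>ground = E, indeps = {Z. Z \<subseteq> E \<and> r Z = card Z}\<rparr> Z = r Z" (is "mrank ?M Z = _")
proof -
  have finE: "finite E" using r by (simp add: rank_fun_def)
  let ?F = "{I \<in> indeps ?M. I \<subseteq> Z}"
  have fin: "finite ?F" using finite_indeps_below[of ?M Z] finE by auto
  have "{} \<in> ?F" using r by (simp add: rank_fun_def)
  then have "mrank ?M Z \<in> card ` ?F" unfolding mrank_def using fin by (intro Max_in) blast+
  then obtain I where I: "I \<subseteq> E" "r I = card I" "I \<subseteq> Z" "mrank ?M Z = card I" by auto
  have "r (insert x I) \<noteq> card (insert x I)" if "x \<in> Z - I" for x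
  proof
    assume "r (insert x I) = card (insert x I)"
    then have "insert x I \<in> ?F" using I Z that by auto
    then have "card (insert x I) \<le> mrank ?M Z" unfolding mrank_def using fin by (intro Max_ge) blast+
    moreover have "finite I" using I finE finite_subset by blast
    ultimately show False using I that by simp
  qed
  then have "r (I \<union> Z) = r I" using rank_fun_not_extendable[OF r I(1,2) Z] by blast
  then show ?thesis using I by (simp add: Un_absorb1)
qed

lemma rank_fun_rank:
  assumes M: "matroid M"
  shows "rank_fun (ground M) (mrank M)"
proof -
  have finM: "finite (ground M)" and sub: "indeps M \<subseteq> Pow (ground M)" and emp: "{} \<in> indeps M"
    and her: "\<And>I J. J \<in> indeps M \<Longrightarrow> I \<subseteq> J \<Longrightarrow> I \<in> indeps M"
    and aug: "\<And>I J. I \<in> indeps M \<Longrightarrow> J \<in> indeps M \<Longrightarrow> card I < card J \<Longrightarrow>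
        \<exists>x\<in>J - I. insert x I \<in> indeps M"
    using M unfolding matroid_def by blast+
  have fin: "finite {I \<in> indeps M. I \<subseteq> X}" for X using finite_indeps_below finM sub by blast
  have finI: "finite I" if "I \<in> indeps M" for I
    using that sub finM finite_subset by blast
  have ge: "card I \<le> mrank M X" if "I \<in> indeps M" "I \<subseteq> X" for I X
    unfolding mrank_def using fin that by (intro Max_ge) auto
  have ex: "\<exists>I\<in>indeps M. I \<subseteq> X \<and> card I = mrank M X" for X
  proof -
    have "mrank M X \<in> card ` {I \<in> indeps M. I \<subseteq> X}"
      unfolding mrank_def using fin emp by (intro Max_in) blast+
    then show ?thesis by auto
  qed
  have extend: "\<exists>K. I \<subseteq> K \<and> K \<in> indeps M \<and> K \<subseteq> X \<and> card K = mrank M X"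
    if "I \<in> indeps M" "I \<subseteq> X" for I X
    using that
  proof (induction "mrank M X - card I" arbitrary: I)
    case 0
    then show ?case using ge[of I X] by (intro exI[of _ I]) auto
  next
    case (Suc n)
    obtain J where J: "J \<in> indeps M" "J \<subseteq> X" "card J = mrank M X" using ex by blast
    then obtain x where x: "x \<in> J - I" "insert x I \<in> indeps M"
      using aug[of I J] Suc.hyps(2) Suc.prems by (metis zero_less_diff zero_less_Suc)
    have "n = mrank M X - card (insert x I)" using Suc x finI by auto
    then obtain K where "insert x I \<subseteq> K" "K \<in> indeps M" "K \<subseteq> X" "card K = mrank M X"
      using Suc.hyps(1)[of "insert x I"] x J Suc.prems by auto
    then show ?case by blast
  qed
  have r0: "mrank M {} = 0" using ex[of "{}"] by auto
  have mono: "mrank M Z \<le> mrank M W" if "Z \<subseteq> W" for Z W using ex[of Z] ge[of _ W] that by force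
  have unit: "mrank M (insert x Z) \<le> Suc (mrank M Z)" for x Z
  proof -
    obtain I where I: "I \<in> indeps M" "I \<subseteq> insert x Z" "card I = mrank M (insert x Z)"
      using ex by blast
    then have "card (I - {x}) \<le> mrank M Z" using her by (intro ge) auto
    moreover have "card I \<le> Suc (card (I - {x}))" using finI[OF I(1)]
      by (metis Diff_empty Diff_insert0 card_Suc_Diff1 le_SucI le_refl)
    ultimately show ?thesis using I by linarith
  qed
  have loc: "mrank M (insert y (insert x Z)) = mrank M Z"
    if "mrank M (insert x Z) = mrank M Z" "mrank M (insert y Z) = mrank M Z" for x y Z
  proof (rule ccontr)
    assume "mrank M (insert y (insert x Z)) \<noteq> mrank M Z"
    then have lt: "mrank M Z < mrank M (insert y (insert x Z))"
      using mono[of Z "insert y (insert x Z)"] by force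
    obtain I where I: "I \<in> indeps M" "I \<subseteq> Z" "card I = mrank M Z" using ex by blast
    obtain J where J: "J \<in> indeps M" "J \<subseteq> insert y (insert x Z)"
        "card J = mrank M (insert y (insert x Z))" using ex by blast
    obtain z where z: "z \<in> J - I" "insert z I \<in> indeps M" using aug[of I J] I J lt by auto
    have c: "card (insert z I) = Suc (mrank M Z)" using z I finI by simp
    have "insert z I \<subseteq> Z \<or> insert z I \<subseteq> insert x Z \<or> insert z I \<subseteq> insert y Z"
      using z J I by blast
    then have "card (insert z I) \<le> mrank M Z" using ge[OF z(2)] that by metis
    then show False using c by simp
  qed
  show ?thesis unfolding rank_fun_def
    by (intro conjI allI impI finM r0 mono unit loc) auto
qed

lemma rank_mono_outside:
  assumes M: "matroid M" and "Z \<subseteq> W"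
  shows "mrank M Z \<le> mrank M W"
proof -
  have fin: "finite {I \<in> indeps M. I \<subseteq> X}" for X
    by (intro finite_indeps_below matroidD M)
  have "{I \<in> indeps M. I \<subseteq> Z} \<noteq> {}" using matroidD(3)[OF M] by blast
  then show ?thesis unfolding mrank_def using fin assms by (intro Max_mono) auto
qed

lemma indeps_iff_rank:
  assumes M: "matroid M"
  shows "Z \<in> indeps M \<longleftrightarrow> Z \<subseteq> ground M \<and> mrank M Z = card Z"
proof
  have fin: "finite {I \<in> indeps M. I \<subseteq> Z}"
    by (intro finite_indeps_below matroidD M)
  {
    assume Z: "Z \<in> indeps M"
    then have "Z \<subseteq> ground M" using matroidD(2)[OF M] by blast
    moreover have "card Z \<le> mrank M Z" unfolding mrank_def using fin Z by (intro Max_ge) auto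
    ultimately show "Z \<subseteq> ground M \<and> mrank M Z = card Z"
      using rank_fun_le_card[OF rank_fun_rank[OF M]] le_antisym by blast
  next
    assume Z: "Z \<subseteq> ground M \<and> mrank M Z = card Z"
    have "{I \<in> indeps M. I \<subseteq> Z} \<noteq> {}" using matroidD(3)[OF M] by blast
    then have "mrank M Z \<in> card ` {I \<in> indeps M. I \<subseteq> Z}"
      unfolding mrank_def using fin by (intro Max_in) blast+
    then obtain I where "I \<in> indeps M" "I \<subseteq> Z" "card I = card Z" using Z by auto
    moreover have "finite Z" using Z matroidD(1)[OF M] finite_subset by blast
    ultimately show "Z \<in> indeps M" using card_subset_eq by metis
  }
qed


subsection \<open>The matroid $M^+(A,B)$\<close>

lemma rank_fun_plus_rank:
  assumes M: "matroid M" and T: "finite T" "ground M \<inter> T = {}" and A: "A \<subseteq> ground M" and B: "B \<subseteq> T"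
  shows "rank_fun (ground M \<union> T) (plus_matroid_rank M A B)"
proof -
  let ?S = "ground M"
  let ?a = "\<lambda>Z. mrank M (Z \<inter> ?S \<union> A)"
  let ?b = "\<lambda>Z. mrank M (Z \<inter> ?S) + card (Z \<inter> B)"
  have r: "rank_fun ?S (mrank M)" using M by (rule rank_fun_rank)
  have finS: "finite ?S" using M by (simp add: matroid_def)
  have finB: "finite (Z \<inter> B)" for Z using B T finite_subset by blast
  have S1: "insert x Z \<inter> ?S = insert x (Z \<inter> ?S)" "insert x Z \<inter> B = Z \<inter> B" if "x \<in> ?S" for x Z
    using that T B by auto
  have T1: "insert x Z \<inter> ?S = Z \<inter> ?S" if "x \<notin> ?S" for x Z
    using that by auto
  have ins: "mrank M X \<le> mrank M (insert x X)" "mrank M (insert x X) \<le> Suc (mrank M X)"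
    if "X \<subseteq> ?S" "x \<in> ?S" for x X
    using r that unfolding rank_fun_def by blast+
  have loc: "mrank M (insert y (insert x X)) = mrank M X"
    if "X \<subseteq> ?S" "x \<in> ?S" "y \<in> ?S" "mrank M (insert x X) = mrank M X" "mrank M (insert y X) = mrank M X"
    for x y X
    using r that unfolding rank_fun_def by blast
  have ainc: "?a Z \<le> ?a (insert x Z) \<and> ?a (insert x Z) \<le> Suc (?a Z)" for x Z
    using ins[of "Z \<inter> ?S \<union> A" x] A S1[of x Z] T1[of x Z]
    by (cases "x \<in> ?S") simp_all
  have cinc: "card (insert x Z \<inter> B) = (if x \<in> B \<and> x \<notin> Z then Suc (card (Z \<inter> B)) else card (Z \<inter> B))"
    for x Z
    using finB[of Z] by (auto simp: insert_absorb)
  have binc: "?b Z \<le> ?b (insert x Z) \<and> ?b (insert x Z) \<le> Suc (?b Z)" for x Z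
    using ins[of "Z \<inter> ?S" x] S1[of x Z] T1[of x Z] cinc[of x Z]
    by (cases "x \<in> ?S") simp_all
  have aloc: "?a (insert y (insert x Z)) = ?a Z"
    if "?a (insert x Z) = ?a Z" "?a (insert y Z) = ?a Z" for x y Z
  proof (cases "x \<in> ?S \<and> y \<in> ?S")
    case True
    then show ?thesis using loc[of "Z \<inter> ?S \<union> A" x y] that A S1 by simp
  next
    case False
    then show ?thesis using that T1[of x Z] T1[of y "insert x Z"] T1[of x] T1[of y]
      by (cases "x \<in> ?S"; cases "y \<in> ?S") (simp_all add: insert_commute)
  qed
  have beq: "mrank M (insert x Z \<inter> ?S) = mrank M (Z \<inter> ?S) \<and> card (insert x Z \<inter> B) = card (Z \<inter> B)"
    if "?b (insert x Z) = ?b Z" for x Z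
  proof (cases "x \<in> ?S")
    case True then show ?thesis using that S1[OF True] by simp
  next
    case False then show ?thesis using that T1[OF False, of Z] by simp
  qed
  have bloc: "?b (insert y (insert x Z)) = ?b Z"
    if "?b (insert x Z) = ?b Z" "?b (insert y Z) = ?b Z" for x y Z
  proof -
    have x: "x \<in> B \<longrightarrow> x \<in> Z" and y: "y \<in> B \<longrightarrow> y \<in> Z"
      using beq[OF that(1)] beq[OF that(2)] cinc[of x Z] cinc[of y Z] by (auto split: if_splits)
    then have c: "insert y (insert x Z) \<inter> B = Z \<inter> B" by auto
    have "mrank M (insert y (insert x Z) \<inter> ?S) = mrank M (Z \<inter> ?S)"
    proof (cases "x \<in> ?S \<and> y \<in> ?S")
      case True
      then show ?thesis using loc[of "Z \<inter> ?S" x y] beq[OF that(1)] beq[OF that(2)] S1 by simp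
    next
      case False
      then show ?thesis using beq[OF that(1)] beq[OF that(2)]
          T1[of x Z] T1[of y "insert x Z"] T1[of x] T1[of y]
        by (cases "x \<in> ?S"; cases "y \<in> ?S") (simp_all add: insert_commute)
    qed
    then show ?thesis using c by simp
  qed
  have dec: "?a (insert x Z) \<le> ?b (insert x Z)" if "?a Z \<le> ?b Z" for x Z
  proof (cases "?b (insert x Z) = ?b Z")
    case False
    then show ?thesis using that ainc[of Z x] binc[of Z x] by linarith
  next
    case True
    have "?a (insert x Z) = ?a Z"
    proof (cases "x \<in> ?S")
      case False then show ?thesis using T1 by simp
    next
      case xS: True
      have fA: "finite A" using A finS finite_subset by blast
      have eq: "mrank M (insert x (Z \<inter> ?S)) = mrank M (Z \<inter> ?S)"
        using True S1[OF xS] by simp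
      have "mrank M (insert x (Z \<inter> ?S \<union> D)) = mrank M (Z \<inter> ?S \<union> D)"
        if "finite D" "D \<subseteq> ?S" for D
        using that
      proof (induction D rule: finite_induct)
        case empty then show ?case using eq by simp
      next
        case (insert d D)
        let ?X = "Z \<inter> ?S \<union> D"
        have X: "?X \<subseteq> ?S" "d \<in> ?S" "insert d ?X \<subseteq> ?S" using insert by auto
        have IH: "mrank M (insert x ?X) = mrank M ?X" using insert by simp
        show ?case
        proof (cases "mrank M (insert d ?X) = mrank M ?X")
          case True
          then show ?thesis using loc[of ?X d x] IH X xS by simp
        next
          case False
          then have "mrank M (insert d ?X) = Suc (mrank M ?X)" using ins[OF X(1,2)] by linarith
          moreover have "mrank M (insert d (insert x ?X)) \<le> Suc (mrank M (insert x ?X))"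
            using ins[of "insert x ?X" d] X xS by blast
          moreover have "mrank M (insert d ?X) \<le> mrank M (insert x (insert d ?X))"
            using ins[OF X(3) xS] by blast
          ultimately show ?thesis using IH by (simp add: insert_commute)
        qed
      qed
      then show ?thesis using fA A S1[OF xS] by simp
    qed
    then show ?thesis using that binc[of Z x] by linarith
  qed
  have m: "plus_matroid_rank M A B Z = min (?a Z) (?b Z)" for Z by (simp add: plus_matroid_rank_def)
  show ?thesis unfolding rank_fun_def
  proof (intro conjI allI impI)
    show "finite (?S \<union> T)" using finS T by simp
    have "mrank M {} = 0" using r by (simp add: rank_fun_def)
    then show "plus_matroid_rank M A B {} = 0" by (simp add: m)
    show "plus_matroid_rank M A B Z \<le> plus_matroid_rank M A B (insert x Z)" for Z x
      unfolding m using ainc[of Z x] binc[of Z x] by linarith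
    show "plus_matroid_rank M A B (insert x Z) \<le> Suc (plus_matroid_rank M A B Z)" for Z x
      unfolding m using ainc[of Z x] binc[of Z x] by linarith
    fix Z x y
    assume x: "plus_matroid_rank M A B (insert x Z) = plus_matroid_rank M A B Z"
      and y: "plus_matroid_rank M A B (insert y Z) = plus_matroid_rank M A B Z"
    show "plus_matroid_rank M A B (insert y (insert x Z)) = plus_matroid_rank M A B Z"
    proof (cases "?a Z \<le> ?b Z")
      case True
      have 1: "?a (insert x Z) \<le> ?b (insert x Z)" "?a (insert y Z) \<le> ?b (insert y Z)"
        "?a (insert y (insert x Z)) \<le> ?b (insert y (insert x Z))"
        using dec True by blast+
      then have "?a (insert x Z) = ?a Z" "?a (insert y Z) = ?a Z" using x y True unfolding m by linarith+
      then have "?a (insert y (insert x Z)) = ?a Z" by (rule aloc)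
      then show ?thesis using 1 True unfolding m by linarith
    next
      case False
      then have "?b (insert x Z) = ?b Z" "?b (insert y Z) = ?b Z"
        using x y ainc[of Z x] ainc[of Z y] binc[of Z x] binc[of Z y] unfolding m by linarith+
      then have "?b (insert y (insert x Z)) = ?b Z" by (rule bloc)
      moreover have "?a Z \<le> ?a (insert y (insert x Z))"
        using ainc[of Z x] ainc[of "insert x Z" y] by linarith
      ultimately show ?thesis using False unfolding m by linarith
    qed
  qed
qed

theorem matroid_plus:
  assumes "matroid M" "finite T" "ground M \<inter> T = {}" "A \<subseteq> ground M" "B \<subseteq> T"
  shows "matroid (plus_matroid M T A B)"
  unfolding plus_matroid_def using matroid_of_rank_fun[OF rank_fun_plus_rank[OF assms]] .

theorem rank_plus:
  assumes "matroid M" "finite T" "ground M \<inter> T = {}" "A \<subseteq> ground M" "B \<subseteq> T"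
    and "X \<subseteq> ground M" "Y \<subseteq> T"
  shows "mrank (plus_matroid M T A B) (X \<union> Y) = min (mrank M (X \<union> A)) (mrank M X + card (Y \<inter> B))"
proof -
  have "mrank (plus_matroid M T A B) (X \<union> Y) = plus_matroid_rank M A B (X \<union> Y)"
    unfolding plus_matroid_def using assms(6,7)
    by (intro rank_of_rank_fun[OF rank_fun_plus_rank[OF assms(1-5)]]) blast
  moreover have "(X \<union> Y) \<inter> ground M = X" "(X \<union> Y) \<inter> B = Y \<inter> B" using assms by blast+
  ultimately show ?thesis by (simp add: plus_matroid_rank_def)
qed

lemma plus_step:
  assumes M: "matroid M" and B: "finite B" "ground M \<inter> B = {}" and A: "A \<subseteq> ground M"
    and b: "b \<notin> ground M" "b \<notin> B"
  shows "principal_extension (plus_matroid M B A B) (mclosure M A) b = plus_matroid M (insert b B) A (insert b B)"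
proof -
  let ?S = "ground M" and ?P = "plus_matroid M B A B"
  note rM = rank_fun_rank[OF M]
  have rP: "rank_fun (?S \<union> B) (plus_matroid_rank M A B)"
    using rank_fun_plus_rank[OF M B A] by simp
  have rankP: "mrank ?P Z = plus_matroid_rank M A B Z" if "Z \<subseteq> ?S \<union> B" for Z
    unfolding plus_matroid_def using rank_of_rank_fun[OF rP that] .
  have finS: "finite ?S" using M by (simp add: matroid_def)
  have subcl: "A \<subseteq> mclosure M A" using A by (auto simp: mclosure_def insert_absorb)
  have clS: "mclosure M A \<subseteq> ?S" by (auto simp: mclosure_def)
  have flat: "mclosure M A \<subseteq> mclosure ?P I \<longleftrightarrow> mrank M (I \<inter> ?S \<union> A) = card I"
    if I: "I \<in> indeps ?P" for I
  proof
    have IE: "I \<subseteq> ?S \<union> B" and rI: "plus_matroid_rank M A B I = card I" using I by (auto simp: plus_matroid_def)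
    {
      assume "mclosure M A \<subseteq> mclosure ?P I"
      then have "plus_matroid_rank M A B (insert x I) = plus_matroid_rank M A B I" if "x \<in> A" for x
        using that subcl A IE rankP[of "insert x I"] rankP[of I] by (fastforce simp: mclosure_def)
      then have "plus_matroid_rank M A B (I \<union> A) = plus_matroid_rank M A B I"
        using A IE finS finite_subset by (intro rank_fun_absorb[OF rP]) blast+
      moreover have "(I \<union> A) \<inter> ?S = I \<inter> ?S \<union> A" "(I \<union> A) \<inter> B = I \<inter> B" using A B by auto
      ultimately have "mrank M (I \<inter> ?S \<union> A) = card I" using rI by (simp add: plus_matroid_rank_def)
      then show "mrank M (I \<inter> ?S \<union> A) = card I" .
    next
      assume eq: "mrank M (I \<inter> ?S \<union> A) = card I"
      show "mclosure M A \<subseteq> mclosure ?P I"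
      proof
        fix x assume x: "x \<in> mclosure M A"
        then have xS: "x \<in> ?S" and xA: "mrank M (insert x A) = mrank M A" by (auto simp: mclosure_def)
        have "mrank M (insert x (A \<union> D)) = mrank M (A \<union> D)" if "finite D" "D \<subseteq> ?S" for D
          using that
        proof (induction D rule: finite_induct)
          case empty then show ?case using xA by simp
        next
          case (insert d D)
          let ?X = "A \<union> D"
          have X: "?X \<subseteq> ?S" "d \<in> ?S" "insert d ?X \<subseteq> ?S" "insert x ?X \<subseteq> ?S"
            using insert A xS by auto
          have IH: "mrank M (insert x ?X) = mrank M ?X" using insert by simp
          have u: "mrank M ?X \<le> mrank M (insert d ?X)" "mrank M (insert d ?X) \<le> Suc (mrank M ?X)"
            "mrank M (insert d (insert x ?X)) \<le> Suc (mrank M (insert x ?X))"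
            "mrank M (insert d ?X) \<le> mrank M (insert x (insert d ?X))"
            using rM X xS unfolding rank_fun_def by blast+
          show ?case
          proof (cases "mrank M (insert d ?X) = mrank M ?X")
            case True
            then have "mrank M (insert x (insert d ?X)) = mrank M ?X"
              using rM IH X xS unfolding rank_fun_def by blast
            then show ?thesis using True by simp
          next
            case False
            then show ?thesis using IH u by (simp add: insert_commute)
          qed
        qed
        from this[of "I \<inter> ?S"] have "mrank M (insert x (I \<inter> ?S) \<union> A) = card I"
          using finS eq by (simp add: Un_commute)
        then have "plus_matroid_rank M A B (insert x I) \<le> card I" using xS by (simp add: plus_matroid_rank_def)
        moreover have "plus_matroid_rank M A B I \<le> plus_matroid_rank M A B (insert x I)"
          using rP IE xS unfolding rank_fun_def by blast
        ultimately have "mrank ?P (insert x I) = mrank ?P I"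
          using rankP[of I] rankP[of "insert x I"] IE xS rI by auto
        then show "x \<in> mclosure ?P I" using xS by (simp add: mclosure_def plus_matroid_def)
      qed
    }
  qed
  have old: "plus_matroid_rank M A (insert b B) Z = plus_matroid_rank M A B Z" if "b \<notin> Z" for Z
    using that by (simp add: plus_matroid_rank_def)
  have new: "plus_matroid_rank M A (insert b B) (insert b I) =
      min (mrank M (I \<inter> ?S \<union> A)) (Suc (mrank M (I \<inter> ?S) + card (I \<inter> B)))" if "b \<notin> I" for I
  proof -
    have "insert b I \<inter> insert b B = insert b (I \<inter> B)" by auto
    then show ?thesis using that b B by (simp add: plus_matroid_rank_def)
  qed
  have newind: "insert b I \<in> indeps (plus_matroid M (insert b B) A (insert b B)) \<longleftrightarrow>
      I \<in> indeps ?P \<and> \<not> mclosure M A \<subseteq> mclosure ?P I" if bI: "b \<notin> I" for I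
  proof (cases "I \<subseteq> ?S \<union> B")
    case False
    then show ?thesis using bI by (auto simp: plus_matroid_def)
  next
    case True
    have finI: "finite I" using True finS B finite_subset by blast
    have c: "card (insert b I) = Suc (card I)" using finI bI by simp
    have le: "mrank M (I \<inter> ?S) + card (I \<inter> B) \<le> card I"
    proof -
      have "card I = card (I \<inter> ?S) + card (I \<inter> B)"
        using True B finI by (subst card_Un_disjoint[symmetric]) (auto intro: arg_cong[of _ _ card])
      moreover have "mrank M (I \<inter> ?S) \<le> card (I \<inter> ?S)" using rank_fun_le_card[OF rM] by simp
      ultimately show ?thesis by simp
    qed
    have L: "insert b I \<in> indeps (plus_matroid M (insert b B) A (insert b B)) \<longleftrightarrow>
      Suc (card I) \<le> mrank M (I \<inter> ?S \<union> A) \<and> mrank M (I \<inter> ?S) + card (I \<inter> B) = card I"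
      using True le by (auto simp: plus_matroid_def new[OF bI] c)
    have R: "I \<in> indeps ?P \<longleftrightarrow>
      card I \<le> mrank M (I \<inter> ?S \<union> A) \<and> mrank M (I \<inter> ?S) + card (I \<inter> B) = card I"
      using True le by (auto simp: plus_matroid_def plus_matroid_rank_def)
    show ?thesis using L R flat[of I] by auto
  qed
  have oldind: "Z \<in> indeps (plus_matroid M (insert b B) A (insert b B)) \<longleftrightarrow> Z \<in> indeps ?P" if "b \<notin> Z" for Z
    using that by (auto simp: plus_matroid_def old)
  have notin: "b \<notin> I" if "I \<in> indeps ?P" for I using that b by (auto simp: plus_matroid_def)
  have "indeps (principal_extension ?P (mclosure M A) b) = indeps (plus_matroid M (insert b B) A (insert b B))"
  proof (intro set_eqI iffI)
    fix Z assume "Z \<in> indeps (principal_extension ?P (mclosure M A) b)"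
    then show "Z \<in> indeps (plus_matroid M (insert b B) A (insert b B))"
      using newind oldind notin by (auto simp: principal_extension_def)
  next
    fix Z assume Z: "Z \<in> indeps (plus_matroid M (insert b B) A (insert b B))"
    show "Z \<in> indeps (principal_extension ?P (mclosure M A) b)"
    proof (cases "b \<in> Z")
      case True
      then have eq: "insert b (Z - {b}) = Z" by blast
      then have "Z - {b} \<in> indeps ?P \<and> \<not> mclosure M A \<subseteq> mclosure ?P (Z - {b})"
        using newind[of "Z - {b}"] Z by simp
      then have "insert b (Z - {b}) \<in> indeps (principal_extension ?P (mclosure M A) b)"
        unfolding principal_extension_def set_system.simps by (intro UnI2 CollectI exI conjI) (rule refl, blast+)
      then show ?thesis by (simp only: eq)
    next
      case False
      then show ?thesis using oldind Z by (simp add: principal_extension_def)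
    qed
  qed
  moreover have "ground (principal_extension ?P (mclosure M A) b) = ground (plus_matroid M (insert b B) A (insert b B))"
    by (simp add: principal_extension_def plus_matroid_def)
  ultimately show ?thesis by (simp add: principal_extension_def plus_matroid_def)
qed

lemma plus_empty:
  assumes M: "matroid M" and A: "A \<subseteq> ground M"
  shows "plus_matroid M {} A {} = M"
proof -
  have "plus_matroid_rank M A {} Z = mrank M Z" if "Z \<subseteq> ground M" for Z
    using that rank_mono_outside[OF M, of Z "Z \<union> A"] by (simp add: plus_matroid_rank_def Int_absorb2 min_def)
  then have "indeps (plus_matroid M {} A {}) = indeps M"
    using indeps_iff_rank[OF M] by (auto simp: plus_matroid_def)
  moreover have "ground (plus_matroid M {} A {}) = ground M" by (simp add: plus_matroid_def)
  ultimately show ?thesis by simp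
qed

lemma plus_loops:
  assumes M: "matroid M" and T: "finite T" "ground M \<inter> T = {}" and A: "A \<subseteq> ground M" and B: "B \<subseteq> T"
  shows "direct_sum (plus_matroid M B A B) (uniform_matroid 0 (T - B)) = plus_matroid M T A B"
proof -
  have finS: "finite (ground M)" using M by (simp add: matroid_def)
  have U: "indeps (uniform_matroid 0 (T - B)) = {{}}"
    using T finite_subset by (fastforce simp: uniform_matroid_def)
  have "Z \<subseteq> ground M \<union> B" if "Z \<subseteq> ground M \<union> T" "plus_matroid_rank M A B Z = card Z" for Z
  proof -
    have finZ: "finite Z" using that finS T finite_subset by blast
    let ?W = "Z \<inter> ground M \<union> Z \<inter> B"
    have "mrank M (Z \<inter> ground M) \<le> card (Z \<inter> ground M)"
      using rank_fun_le_card[OF rank_fun_rank[OF M]] by simp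
    moreover have "card ?W = card (Z \<inter> ground M) + card (Z \<inter> B)"
      using finZ T B by (intro card_Un_disjoint) auto
    ultimately have "card Z \<le> card ?W" using that by (simp add: plus_matroid_rank_def)
    moreover have "?W \<subseteq> Z" by blast
    ultimately have "?W = Z" using finZ by (meson card_seteq)
    then show ?thesis by blast
  qed
  then have "indeps (direct_sum (plus_matroid M B A B) (uniform_matroid 0 (T - B))) = indeps (plus_matroid M T A B)"
    using B by (auto simp: direct_sum_def U plus_matroid_def)
  moreover have "ground (direct_sum (plus_matroid M B A B) (uniform_matroid 0 (T - B))) = ground (plus_matroid M T A B)"
    using B by (auto simp: direct_sum_def uniform_matroid_def plus_matroid_def)
  ultimately show ?thesis by (simp add: direct_sum_def plus_matroid_def)
qed

theorem plus_eq_principal_extensions: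
  assumes M: "matroid M" and T: "finite T" "ground M \<inter> T = {}" and A: "A \<subseteq> ground M"
    and bs: "distinct bs" "set bs \<subseteq> T"
  shows "plus_matroid M T A (set bs) =
    direct_sum (foldr (\<lambda>b M'. principal_extension M' (mclosure M A) b) bs M) (uniform_matroid 0 (T - set bs))"
proof -
  have "foldr (\<lambda>b M'. principal_extension M' (mclosure M A) b) bs M = plus_matroid M (set bs) A (set bs)"
    using bs
  proof (induction bs)
    case Nil
    then show ?case using plus_empty[OF M A] by simp
  next
    case (Cons b bs)
    then have "ground M \<inter> set bs = {}" "b \<notin> ground M" using T by auto
    then show ?case using Cons plus_step[OF M _ _ A, of "set bs" b] by simp
  qed
  then show ?thesis using plus_loops[OF M T A bs(2)] by simp
qed

end

theory Submission
  imports Defs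
begin

text \<open>The rank of \<open>X \<union> Y\<close> in the principal sum is the minimum of
  \<open>a = r\<^sub>M(X \<union> A) + r\<^sub>N(Y)\<close> and \<open>b = r\<^sub>M(X) + r\<^sub>N(Y - B) + |Y \<inter> B|\<close>. It is attained by a basis of \<open>X\<close>,
  a basis of \<open>Y\<close> that extends one of \<open>Y - B\<close>, and as many of the unused elements of \<open>Y \<inter> B\<close> as
  fit into the flat spanned by \<open>X \<union> A\<close>. Adding an element \<open>z\<close> raises each of \<open>a\<close> and \<open>b\<close> by at
  most one, and it raises \<open>b\<close> whenever it raises \<open>a\<close>; hence \<open>z\<close> lies in the closure iff it does not
  raise the smaller of the two, where \<open>a\<close> decides in case of a tie.\<close>

section \<open>Spans and bases\<close>

text \<open>The elements of \<open>W - Z\<close> are added one at a time. If \<open>d\<close> leaves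
  the rank of \<open>?X\<close> unchanged, local submodularity applies to \<open>d\<close> and
  \<open>x\<close>. If \<open>d\<close> raises it, then \<open>insert d ?X\<close> and
  \<open>insert x (insert d ?X)\<close> both have rank \<open>r ?X + 1\<close>, because
  \<open>d\<close> adds at most one to the rank of \<open>insert x ?X\<close>.\<close>

lemma rank_fun_insert_eq_mono:
  assumes r: "rank_fun E r" and "Z \<subseteq> W" "W \<subseteq> E" "x \<in> E" and "r (insert x Z) = r Z"
  shows "r (insert x W) = r W"
proof -
  have "finite (W - Z)" using assms by (meson finite_Diff finite_subset rank_fun_def)
  moreover have "finite D \<Longrightarrow> D \<subseteq> E \<Longrightarrow> r (insert x (Z \<union> D)) = r (Z \<union> D)" for D
  proof (induction D rule: finite_induct)
    case (insert d D)
    let ?X = "Z \<union> D"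
    have X: "?X \<subseteq> E" "d \<in> E" "insert d ?X \<subseteq> E" "insert x ?X \<subseteq> E" using assms insert by auto
    have IH: "r (insert x ?X) = r ?X" using insert by simp
    show ?case
    proof (cases "r (insert d ?X) = r ?X")
      case True
      then show ?thesis using rank_fun_local[OF r X(1,2) \<open>x \<in> E\<close> True IH] by simp
    next
      case False
      then show ?thesis
        using IH rank_fun_insert[OF r X(1,2)] rank_fun_insert(2)[OF r X(4,2)]
          rank_fun_insert(1)[OF r X(3) \<open>x \<in> E\<close>]
        by (simp add: insert_commute)
    qed
  qed (use assms in simp)
  ultimately have "r (insert x (Z \<union> (W - Z))) = r (Z \<union> (W - Z))" using assms by blast
  then show ?thesis using assms by (simp add: Un_absorb1)
qed

text \<open>Each \<open>x\<close> in \<open>W\<close> satisfies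
  \<open>r Z \<le> r (insert x Z) \<le> r W\<close>, so it lies in the span of \<open>Z\<close>,
  hence in that of \<open>Z \<union> A\<close>, which therefore absorbs all of \<open>W\<close>.
  This lets a basis of \<open>X\<close> replace \<open>X\<close> in
  \<open>r (X \<union> A)\<close>.\<close>

lemma rank_fun_Un_eq:
  assumes r: "rank_fun E r" and "Z \<subseteq> W" "W \<subseteq> E" "A \<subseteq> E" and "r Z = r W"
  shows "r (Z \<union> A) = r (W \<union> A)"
proof -
  have "r (insert x (Z \<union> A)) = r (Z \<union> A)" if "x \<in> W" for x
  proof (rule rank_fun_insert_eq_mono[OF r, of Z])
    have "r Z \<le> r (insert x Z)" "r (insert x Z) \<le> r W"
      by (rule rank_fun_mono[OF r]; use assms that in blast)+
    then show "r (insert x Z) = r Z" using assms by simp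
  qed (use assms that in auto)
  moreover have "finite W" using assms by (meson finite_subset rank_fun_def)
  ultimately have "r (Z \<union> A \<union> W) = r (Z \<union> A)" using assms by (intro rank_fun_absorb[OF r]) auto
  moreover have "Z \<union> A \<union> W = W \<union> A" using assms by blast
  ultimately show ?thesis by simp
qed

text \<open>An inclusion-maximal independent set between \<open>I\<close> and \<open>X\<close>
  admits no further element of \<open>X\<close>, so it spans \<open>X\<close>. Starting from a given
  \<open>I\<close> is what provides nested bases of \<open>Y - B\<close> and
  \<open>Y\<close>.\<close>

lemma indep_extend_basis:
  assumes M: "matroid M" and "I \<in> indeps M" "I \<subseteq> X" "X \<subseteq> ground M"
  shows "\<exists>K. I \<subseteq> K \<and> K \<subseteq> X \<and> K \<in> indeps M \<and> card K = mrank M X"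
proof -
  have finX: "finite X" using assms matroidD(1)[OF M] finite_subset by blast
  let ?F = "{K. I \<subseteq> K \<and> K \<subseteq> X \<and> K \<in> indeps M}"
  have fin: "finite ?F" by (rule finite_subset[of _ "Pow X"]) (use finX in auto)
  have "?F \<noteq> {}" using assms by blast
  from finite_has_maximal[OF fin this]
  obtain K where K: "K \<in> ?F" and max: "\<forall>L\<in>?F. K \<subseteq> L \<longrightarrow> K = L" by (elim bexE)
  have rK: "K \<subseteq> ground M" "mrank M K = card K" using K indeps_iff_rank[OF M] by auto
  have "mrank M (insert x K) \<noteq> card (insert x K)" if "x \<in> X - K" for x
  proof
    assume "mrank M (insert x K) = card (insert x K)"
    then have "insert x K \<in> ?F" using that K assms rK indeps_iff_rank[OF M] by auto
    then have "K = insert x K" using max by blast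
    then show False using that by blast
  qed
  then have "mrank M (K \<union> X) = mrank M K"
    using rank_fun_not_extendable[OF rank_fun_rank[OF M] rK] assms by blast
  moreover have "K \<union> X = X" using K by blast
  ultimately have "card K = mrank M X" using rK by simp
  then show ?thesis using K by blast
qed

section \<open>Independent sets and rank of the principal sum\<close>

lemma ground_principal_sum: "ground (principal_sum M N A B) = ground M \<union> ground N"
  by (auto simp: principal_sum_def matroid_union_def plus_matroid_def direct_sum_def
      uniform_matroid_def)

text \<open>Added loops contribute only the empty independent set. Finiteness of
  \<open>ground M\<close> matters here, since \<open>card\<close> of an infinite set is 0 and such a
  set would count as independent in \<open>uniform_matroid 0\<close>.\<close>

lemma indeps_principal_sum:
  assumes "finite (ground M)"
  shows "indeps (principal_sum M N A B) =
    {I \<union> J | I J. I \<in> indeps (plus_matroid M (ground N) A B) \<and> J \<in> indeps N}"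
proof -
  have "indeps (uniform_matroid 0 (ground M)) = {{}}"
    using assms finite_subset by (fastforce simp: uniform_matroid_def)
  then show ?thesis by (simp add: principal_sum_def matroid_union_def direct_sum_def)
qed

lemma mrank_eqI:
  assumes "finite X" and "K \<in> indeps M" "K \<subseteq> X" "card K = k"
    and "\<And>I. I \<in> indeps M \<Longrightarrow> I \<subseteq> X \<Longrightarrow> card I \<le> k"
  shows "mrank M X = k"
  unfolding mrank_def
proof (rule Max_eqI)
  show "finite (card ` {I \<in> indeps M. I \<subseteq> X})"
    by (rule finite_imageI, rule finite_subset[of _ "Pow X"]) (use assms in auto)
qed (use assms in auto)

context
  fixes M N :: "'a set_system" and A B :: "'a set"
  assumes M: "matroid M" and N: "matroid N" and disj: "ground M \<inter> ground N = {}"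
    and A: "A \<subseteq> ground M" and B: "B \<subseteq> ground N"
begin

text \<open>Split \<open>K\<close> into \<open>I\<close>, independent in the extension of
  \<open>M\<close>, and \<open>J\<close>, independent in \<open>N\<close>. The two terms of the
  minimum in \<open>plus_matroid_rank\<close> bound \<open>card I\<close> and give one inequality
  each; for the second, \<open>J\<close> is further split along \<open>B\<close>.\<close>

lemma card_indep_principal_sum_le:
  assumes X: "X \<subseteq> ground M" and Y: "Y \<subseteq> ground N"
    and K: "K \<in> indeps (principal_sum M N A B)" "K \<subseteq> X \<union> Y"
  shows "card K \<le> mrank M (X \<union> A) + mrank N Y"
    and "card K \<le> mrank M X + mrank N (Y - B) + card (Y \<inter> B)"
proof -
  note finM = matroidD(1)[OF M] and finN = matroidD(1)[OF N]
  obtain I J where IJ: "K = I \<union> J" "J \<in> indeps N"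
    and I: "plus_matroid_rank M A B I = card I"
    using K(1) by (auto simp: indeps_principal_sum[OF finM] plus_matroid_def)
  have J: "J \<subseteq> ground N" "mrank N J = card J" using IJ(2) indeps_iff_rank[OF N] by auto
  have sub: "J \<subseteq> Y" "I \<inter> ground M \<subseteq> X" "I \<subseteq> X \<union> Y"
    using J(1) K(2) X Y IJ(1) disj by blast+
  have "finite Y" "finite X" using X Y finM finN finite_subset by auto
  then have fin: "finite I" "finite J" "finite (Y \<inter> B)"
    using finite_subset[OF sub(1)] finite_subset[OF sub(3)] by simp_all
  have "mrank M (I \<inter> ground M \<union> A) \<le> mrank M (X \<union> A)"
    by (rule rank_mono_outside[OF M]) (use sub in blast)
  then have "card I \<le> mrank M (X \<union> A)" using I unfolding plus_matroid_rank_def by linarith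
  moreover have "card J \<le> mrank N Y" using J sub rank_mono_outside[OF N] by metis
  moreover have "card K \<le> card I + card J" using IJ card_Un_le by auto
  ultimately show "card K \<le> mrank M (X \<union> A) + mrank N Y" by linarith
  have 1: "card I \<le> mrank M X + card (I \<inter> B)"
    using I rank_mono_outside[OF M sub(2)] unfolding plus_matroid_rank_def by linarith
  have "J - B \<in> indeps N" using IJ(2) N unfolding matroid_def by blast
  then have "mrank N (J - B) = card (J - B)" using indeps_iff_rank[OF N] by auto
  then have 2: "card (J - B) \<le> mrank N (Y - B)"
    using rank_mono_outside[OF N, of "J - B" "Y - B"] sub by auto
  \<comment> \<open>\<open>I\<close> and \<open>J\<close> may share elements of \<open>B\<close>;
    each element of \<open>Y \<inter> B\<close> is charged only once.\<close>
  have "card (I \<inter> B) + card (J \<inter> B - I) = card ((I \<inter> B) \<union> (J \<inter> B - I))"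
    using fin by (intro card_Un_disjoint[symmetric]) auto
  also have "\<dots> \<le> card (Y \<inter> B)" using fin(3) sub(1,3) X B disj by (intro card_mono) blast+
  finally have 3: "card (I \<inter> B) + card (J \<inter> B - I) \<le> card (Y \<inter> B)" .
  have "K = I \<union> ((J - B) \<union> (J \<inter> B - I))" using IJ by auto
  then have "card K \<le> card I + (card (J - B) + card (J \<inter> B - I))"
    using card_Un_le[of I "(J - B) \<union> (J \<inter> B - I)"] card_Un_le[of "J - B" "J \<inter> B - I"] by simp
  then show "card K \<le> mrank M X + mrank N (Y - B) + card (Y \<inter> B)" using 1 2 3 by linarith
qed

lemma mrank_principal_sum:
  assumes X: "X \<subseteq> ground M" and Y: "Y \<subseteq> ground N"
  shows "mrank (principal_sum M N A B) (X \<union> Y) =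
    min (mrank M (X \<union> A) + mrank N Y) (mrank M X + mrank N (Y - B) + card (Y \<inter> B))"
proof -
  note finM = matroidD(1)[OF M] and finN = matroidD(1)[OF N]
  have finXY: "finite X" "finite Y" using X Y finM finN finite_subset by auto
  obtain I0 where I0: "I0 \<subseteq> X" "I0 \<in> indeps M" "card I0 = mrank M X"
    using indep_extend_basis[OF M matroidD(3)[OF M] _ X] by blast
  have rI0: "mrank M I0 = card I0" using I0 indeps_iff_rank[OF M] by auto
  have rI0A: "mrank M (I0 \<union> A) = mrank M (X \<union> A)"
    using rank_fun_Un_eq[OF rank_fun_rank[OF M] I0(1) X A] rI0 I0 by simp
  obtain J0 where J0: "J0 \<subseteq> Y - B" "J0 \<in> indeps N" "card J0 = mrank N (Y - B)"
    using indep_extend_basis[OF N matroidD(3)[OF N], of "Y - B"] Y by blast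
  obtain J where J: "J0 \<subseteq> J" "J \<subseteq> Y" "J \<in> indeps N" "card J = mrank N Y"
    using indep_extend_basis[OF N J0(2), of Y] J0 Y by blast
  have finJ: "finite J" "finite I0"
    using finite_subset[OF J(2)] finite_subset[OF I0(1)] finXY by blast+
  \<comment> \<open>As \<open>J\<close> contains the basis \<open>J0\<close> of
    \<open>Y - B\<close>, its part \<open>J - B\<close> is itself such a basis, so
    \<open>J \<inter> B\<close> accounts for the difference of \<open>mrank N Y\<close> and
    \<open>mrank N (Y - B)\<close>.\<close>
  have "J - B \<in> indeps N" using J N unfolding matroid_def by blast
  then have "card (J - B) \<le> mrank N (Y - B)"
    using indeps_iff_rank[OF N] rank_mono_outside[OF N, of "J - B" "Y - B"] J by auto
  moreover have "card J0 \<le> card (J - B)" using finJ J J0 by (intro card_mono) auto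
  moreover have "card J = card (J - B) + card (J \<inter> B)"
    using finJ by (subst card_Un_disjoint[symmetric]) (auto intro: arg_cong[of _ _ card])
  ultimately have cJB: "mrank N Y = mrank N (Y - B) + card (J \<inter> B)" using J J0 by linarith
  have cYB: "card (Y \<inter> B) = card (Y \<inter> B - J) + card (J \<inter> B)"
    using finXY finJ J by (subst card_Un_disjoint[symmetric]) (auto intro: arg_cong[of _ _ card])
  \<comment> \<open>The elements of \<open>B\<close> placed next to \<open>I0\<close> must avoid
    \<open>J\<close> to count in the union, and the room left for them in the span of
    \<open>X \<union> A\<close> is the second term; that subtraction does not truncate, by
    \<open>leA\<close>.\<close>
  let ?k = "min (card (Y \<inter> B - J)) (mrank M (X \<union> A) - mrank M X)"
  obtain L where L: "L \<subseteq> Y \<inter> B - J" "card L = ?k"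
    using obtain_subset_with_card_n[of ?k "Y \<inter> B - J"] by (metis min.cobounded1)
  have finL: "finite L" using L finXY finite_subset by blast
  have leA: "mrank M X \<le> mrank M (X \<union> A)" by (rule rank_mono_outside[OF M]) simp
  have ints: "(I0 \<union> L) \<inter> ground M = I0" "(I0 \<union> L) \<inter> B = L" "I0 \<inter> L = {}"
    using I0(1) L(1) X Y B disj by blast+
  have cI: "card (I0 \<union> L) = mrank M X + ?k"
    using card_Un_disjoint[OF finJ(2) finL ints(3)] I0 L by simp
  have "plus_matroid_rank M A B (I0 \<union> L) = card (I0 \<union> L)"
    unfolding plus_matroid_rank_def ints rI0A rI0 cI using I0 L leA by linarith
  then have "I0 \<union> L \<in> indeps (plus_matroid M (ground N) A B)"
    using I0 L X Y by (auto simp: plus_matroid_def)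
  then have ind: "I0 \<union> L \<union> J \<in> indeps (principal_sum M N A B)"
    using J by (auto simp: indeps_principal_sum[OF finM])
  have "(I0 \<union> L) \<inter> J = {}" using I0(1) L(1) J(2) X Y disj by blast
  then have "card (I0 \<union> L \<union> J) = mrank M X + ?k + mrank N Y"
    using card_Un_disjoint[of "I0 \<union> L" J] finJ finL cI J by simp
  \<comment> \<open>If \<open>?k\<close> is the remaining room, the size is the first bound; if all
    of \<open>Y \<inter> B - J\<close> is used, \<open>cJB\<close> and \<open>cYB\<close> turn it
    into the second.\<close>
  then have "card (I0 \<union> L \<union> J) =
      min (mrank M (X \<union> A) + mrank N Y) (mrank M X + mrank N (Y - B) + card (Y \<inter> B))"
    using leA cJB cYB by linarith
  then show ?thesis
    using card_indep_principal_sum_le[OF X Y] I0 L J finXY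
    by (intro mrank_eqI[OF _ ind]) auto
qed

end

section \<open>Closure in the principal sum\<close>

lemma mrank_deletion:
  assumes "Z \<inter> D = {}"
  shows "mrank (deletion N D) Z = mrank N Z"
proof -
  have "{I \<in> indeps (deletion N D). I \<subseteq> Z} = {I \<in> indeps N. I \<subseteq> Z}"
    using assms by (auto simp: deletion_def)
  then show ?thesis by (simp add: mrank_def)
qed

theorem theorem3p10:
  fixes M N :: "'a set_system" and A B X Y :: "'a set"
  assumes "matroid M" and "matroid N" and "ground M \<inter> ground N = {}"
    and "A \<subseteq> ground M" and "B \<subseteq> ground N"
    and "X \<subseteq> ground M" and "Y \<subseteq> ground N"
  shows "mclosure (principal_sum M N A B) (X \<union> Y) =
    (if mrank M (X \<union> A) + mrank N Y \<le> mrank M X + mrank N (Y - B) + card (Y \<inter> B)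
     then mclosure M (X \<union> A) \<union> mclosure N Y
     else mclosure M X \<union> mclosure (deletion N B) (Y - B) \<union> (Y \<inter> B))"
    (is "?cl = (if ?a \<le> ?b then ?U else ?V)")
proof -
  let ?P = "principal_sum M N A B"
  note rank = mrank_principal_sum[OF assms(1-5)]
  note rM = rank_fun_rank[OF assms(1)] and rN = rank_fun_rank[OF assms(2)]
  have finYB: "finite (Y \<inter> B)" using finite_subset[OF assms(7) matroidD(1)[OF assms(2)]] by simp
  have inM: "z \<in> ?cl \<longleftrightarrow> z \<in> (if ?a \<le> ?b then ?U else ?V)" if z: "z \<in> ground M" for z
  proof -
    have zN: "z \<notin> ground N" using z assms by blast
    have cl: "z \<in> ?cl \<longleftrightarrow> min (mrank M (insert z (X \<union> A)) + mrank N Y)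
        (mrank M (insert z X) + mrank N (Y - B) + card (Y \<inter> B)) = min ?a ?b"
      using rank[of "insert z X" Y] rank[of X Y] z assms
      by (simp add: mclosure_def ground_principal_sum)
    \<comment> \<open>Contrapositive form of the claim that raising \<open>?a\<close> raises
      \<open>?b\<close>.\<close>
    have "mrank M (insert z X) = mrank M X \<Longrightarrow> mrank M (insert z (X \<union> A)) = mrank M (X \<union> A)"
      using rank_fun_insert_eq_mono[OF rM, of X "X \<union> A" z] z assms by simp
    moreover have "mrank M (X \<union> A) \<le> mrank M (insert z (X \<union> A))" "mrank M X \<le> mrank M (insert z X)"
      using rank_fun_insert[OF rM] z assms by auto
    moreover have "z \<in> ?U \<longleftrightarrow> mrank M (insert z (X \<union> A)) = mrank M (X \<union> A)"
      "z \<in> ?V \<longleftrightarrow> mrank M (insert z X) = mrank M X"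
      using z zN assms(7) by (auto simp: mclosure_def deletion_def)
    ultimately show ?thesis unfolding cl by (cases "?a \<le> ?b") auto
  qed
  have inN: "z \<in> ?cl \<longleftrightarrow> z \<in> (if ?a \<le> ?b then ?U else ?V)" if z: "z \<in> ground N" for z
  proof -
    have zM: "z \<notin> ground M" using z assms by blast
    let ?b' = "mrank M X + mrank N (insert z Y - B) + card (insert z Y \<inter> B)"
    have cl: "z \<in> ?cl \<longleftrightarrow> min (mrank M (X \<union> A) + mrank N (insert z Y)) ?b' = min ?a ?b"
      using rank[of X "insert z Y"] rank[of X Y] z assms
      by (simp add: mclosure_def ground_principal_sum)
    have U: "z \<in> ?U \<longleftrightarrow> mrank N (insert z Y) = mrank N Y"
      using z zM by (auto simp: mclosure_def)
    have a: "mrank N Y \<le> mrank N (insert z Y)" using rank_fun_insert[OF rN] z assms by auto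
    \<comment> \<open>These are the facts about \<open>?b\<close> that the comparison of minima
      requires; the two cases differ in which summand of \<open>?b\<close> the element
      \<open>z\<close> affects.\<close>
    have "?b \<le> ?b' \<and> (?b' = ?b \<longrightarrow> mrank N (insert z Y) = mrank N Y) \<and> (z \<in> ?V \<longleftrightarrow> ?b' = ?b)"
    proof (cases "z \<in> B")
      case True
      \<comment> \<open>An element of \<open>B\<close> is not in the ground set of the deletion, and
        it raises \<open>?b\<close> through \<open>card\<close> exactly when it is new to
        \<open>Y\<close>.\<close>
      then have "z \<in> ?V \<longleftrightarrow> z \<in> Y" using zM by (auto simp: mclosure_def deletion_def)
      moreover have "insert z Y - B = Y - B" "insert z Y \<inter> B = insert z (Y \<inter> B)" using True by auto
      ultimately show ?thesis using True finYB by (auto simp: card_insert_if insert_absorb)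
    next
      case False
      have eq: "insert z Y - B = insert z (Y - B)" "insert z Y \<inter> B = Y \<inter> B" using False by auto
      \<comment> \<open>Both sets avoid \<open>B\<close>, so closure of \<open>Y - B\<close> in the
        deletion can be tested by ranks in \<open>N\<close>.\<close>
      have "mrank (deletion N B) (insert z (Y - B)) = mrank N (insert z (Y - B))"
        "mrank (deletion N B) (Y - B) = mrank N (Y - B)"
        using False by (intro mrank_deletion; blast)+
      moreover have "ground (deletion N B) = ground N - B" by (simp add: deletion_def)
      ultimately have "z \<in> ?V \<longleftrightarrow> mrank N (insert z (Y - B)) = mrank N (Y - B)"
        using False z zM by (auto simp: mclosure_def)
      moreover have "mrank N (Y - B) \<le> mrank N (insert z (Y - B))"
        by (rule rank_mono_outside[OF assms(2)]) blast
      moreover have "mrank N (insert z (Y - B)) = mrank N (Y - B) \<Longrightarrow> mrank N (insert z Y) = mrank N Y"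
        using rank_fun_insert_eq_mono[OF rN, of "Y - B" Y z] z assms by blast
      ultimately show ?thesis unfolding eq by auto
    qed
    then show ?thesis unfolding cl using U a by (cases "?a \<le> ?b") auto
  qed
  have sub: "?cl \<subseteq> ground M \<union> ground N"
    "(if ?a \<le> ?b then ?U else ?V) \<subseteq> ground M \<union> ground N"
    using assms by (auto simp: mclosure_def ground_principal_sum deletion_def)
  show ?thesis
  proof (rule set_eqI)
    fix z
    consider "z \<in> ground M" | "z \<in> ground N" | "z \<notin> ground M \<union> ground N" by blast
    then show "z \<in> ?cl \<longleftrightarrow> z \<in> (if ?a \<le> ?b then ?U else ?V)"
    proof cases
      case 1 then show ?thesis by (rule inM)
    next
      case 2 then show ?thesis by (rule inN)
    next
      case 3 then show ?thesis using subsetD[OF sub(1)] subsetD[OF sub(2)] by metis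
    qed
  qed
qed

end
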